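(* Let $(\mathbf{X},\mathbf{T})$ be a nonautonomous dynamical system, let $E\subset X_0$ be a Borel set, let $s\in\mathbb{R}$, let $\mu$ be a Borel probability measure on $X_0$ and let $\mathbf{f}\in\mathbf{C}(\mathbf{X},\mathbb{R})$. (1) If $\underline{P}_{\mu}(\mathbf{T},\mathbf{f},x)\le s$ for all $x\in E$, then $P^{\mathrm{B}}(\mathbf{T},\mathbf{f},E)\le s$. (2) If $\mathbf{f}$ is equicontinuous, $\underline{P}_{\mu}(\mathbf{T},\mathbf{f},x)\ge s$ for all $x\in E$, and $\mu(E)>0$, then $P^{\mathrm{B}}(\mathbf{T},\mathbf{f},E)\ge s$.
   Context: A nonautonomous dynamical system (NDS) $(\mathbf{X},\mathbf{T})$ consists of a sequence $\mathbf{X}=\{X_k\}_{k=0}^\infty$ of compact metric spaces $(X_k,d_k)$ and a sequence $\mathbf{T}=\{T_k\}_{k=0}^\infty$ of continuous maps $T_k:X_k\to X_{k+1}$. Put $\mathbf{T}^0=\mathrm{id}_{X_0}$ and $\mathbf{T}^j=T_{j-1}\circ\cdots\circ T_0:X_0\to X_j$. For $n\ge1$ and $x,y\in X_0$ let $d_n^{\mathbf{T}}(x,y)=\max_{0\le j\le n-1}d_j(\mathbf{T}^jx,\mathbf{T}^jy)$, and for $\varepsilon>0$ let $B_n^{\mathbf{T}}(x,\varepsilon)=\{y\in X_0:d_n^{\mathbf{T}}(x,y)<\varepsilon\}$ (Bowen ball). $\mathbf{C}(\mathbf{X},\mathbb{R})=\prod_{k\ge0}C(X_k,\mathbb{R})$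 is the set of sequences $\mathbf{f}=\{f_k\}_{k=0}^\infty$ of continuous functions $f_k:X_k\to\mathbb{R}$. $\mathbf{f}$ is equicontinuous if for every $\varepsilon>0$ there is $\delta>0$ such that for all $k\ge0$ and all $x',x''\in X_k$ with $d_k(x',x'')<\delta$ one has $|f_k(x')-f_k(x'')|<\varepsilon$. Put $S_n^{\mathbf{T}}\mathbf{f}=\sum_{j=0}^{n-1}f_j\circ\mathbf{T}^j$. Measure-theoretic lower local pressure: $\underline{P}_\mu(\mathbf{T},\mathbf{f},x)=\lim_{\varepsilon\to0}\liminf_{n\to\infty}\frac{-\log\mu(B_n^{\mathbf{T}}(x,\varepsilon))+S_n^{\mathbf{T}}\mathbf{f}(x)}{n}\in\mathbb{R}\cup\{\pm\infty\}$, with $\log0=-\infty$ (the inner quantity is non-increasing in $\varepsilon$, so the limit exists). Bowen pressure: for $Z\subset X_0$, an $(N,\varepsilon)$-cover of $Z$ is a family $\{B_{n_i}^{\mathbf{T}}(x_i,\varepsilon)\}_i$ with $x_i\in X_0$ and integers $n_i\ge N$ whose union contains $Z$. For $s\in\mathbb{R}$, $N>0$, $\varepsilon>0$ let $\mathscr{R}_{N,\varepsilon}^{s}(\mathbf{T},\mathbf{f},Z)=\inf\sum_i\exp(-n_is+S_{n_i}^{\mathbf{T}}\mathbf{f}(x_i))$, the infimum over all countable (finite or infinite) $(N,\varepsilon)$-covers of $Z$. Let $\mathscr{R}_{\varepsilon}^{s}(\mathbf{T},\mathbf{f},Z)=\lim_{N\to\infty}\mathscr{R}_{N,\varepsilon}^{s}(\mathbf{T},\mathbf{f},Z)$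 and $P^{\mathrm{B}}(\mathbf{T},\mathbf{f},Z,\varepsilon)=\inf\{s:\mathscr{R}_{\varepsilon}^{s}(\mathbf{T},\mathbf{f},Z)=0\}=\sup\{s:\mathscr{R}_{\varepsilon}^{s}(\mathbf{T},\mathbf{f},Z)=+\infty\}$. Then $P^{\mathrm{B}}(\mathbf{T},\mathbf{f},Z)=\lim_{\varepsilon\to0}P^{\mathrm{B}}(\mathbf{T},\mathbf{f},Z,\varepsilon)$ (monotone limit). *)

theory Defs
  imports "HOL-Probability.Probability"
begin

text \<open>
  The spaces are given as a sequence of values of type \<open>'a metric\<close>, so each has its own carrier
  set and its own distance function. The common ambient type \<open>'a\<close> is no restriction, since the
  carriers need not be related to one another (take a disjoint sum).
\<close>

definition nds :: "(nat \<Rightarrow> 'a metric) \<Rightarrow> (nat \<Rightarrow> 'a \<Rightarrow> 'a) \<Rightarrow> bool" where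
  "nds X T \<longleftrightarrow>
     (\<forall>k. compact_space (mtopology_of (X k))) \<and>
     (\<forall>k. continuous_map (mtopology_of (X k)) (mtopology_of (X (Suc k))) (T k))"

primrec nds_iter :: "(nat \<Rightarrow> 'a \<Rightarrow> 'a) \<Rightarrow> nat \<Rightarrow> 'a \<Rightarrow> 'a" where
  "nds_iter T 0 = id"
| "nds_iter T (Suc j) = T j \<circ> nds_iter T j"

text \<open>Only meaningful for \<open>n \<ge> 1\<close>; the value at \<open>n = 0\<close> does not affect any of the limits below.\<close>

definition bowen_dist :: "(nat \<Rightarrow> 'a metric) \<Rightarrow> (nat \<Rightarrow> 'a \<Rightarrow> 'a) \<Rightarrow> nat \<Rightarrow> 'a \<Rightarrow> 'a \<Rightarrow> real" where
  "bowen_dist X T n x y = (MAX j\<in>{0..n - 1}. mdist (X j) (nds_iter T j x) (nds_iter T j y))"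

definition bowen_ball :: "(nat \<Rightarrow> 'a metric) \<Rightarrow> (nat \<Rightarrow> 'a \<Rightarrow> 'a) \<Rightarrow> nat \<Rightarrow> 'a \<Rightarrow> real \<Rightarrow> 'a set" where
  "bowen_ball X T n x \<epsilon> = {y \<in> mspace (X 0). bowen_dist X T n x y < \<epsilon>}"

definition continuous_potential :: "(nat \<Rightarrow> 'a metric) \<Rightarrow> (nat \<Rightarrow> 'a \<Rightarrow> real) \<Rightarrow> bool" where
  "continuous_potential X f \<longleftrightarrow> (\<forall>k. continuous_map (mtopology_of (X k)) euclideanreal (f k))"

definition equicontinuous_potential :: "(nat \<Rightarrow> 'a metric) \<Rightarrow> (nat \<Rightarrow> 'a \<Rightarrow> real) \<Rightarrow> bool" where
  "equicontinuous_potential X f \<longleftrightarrow>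
     (\<forall>\<epsilon>>0. \<exists>\<delta>>0. \<forall>k. \<forall>x'\<in>mspace (X k). \<forall>x''\<in>mspace (X k).
        mdist (X k) x' x'' < \<delta> \<longrightarrow> \<bar>f k x' - f k x''\<bar> < \<epsilon>)"

definition birkhoff_sum ::
  "(nat \<Rightarrow> 'a \<Rightarrow> 'a) \<Rightarrow> (nat \<Rightarrow> 'a \<Rightarrow> real) \<Rightarrow> nat \<Rightarrow> 'a \<Rightarrow> real" where
  "birkhoff_sum T f n x = (\<Sum>j<n. f j (nds_iter T j x))"

definition metric_borel :: "'a metric \<Rightarrow> 'a measure" where
  "metric_borel m = sigma (mspace m) {U. openin (mtopology_of m) U}"

text \<open>Used only for \<open>p \<ge> 0\<close>.\<close>

definition log_ereal :: "real \<Rightarrow> ereal" where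
  "log_ereal p = (if p = 0 then -\<infinity> else ereal (ln p))"

definition lower_local_pressure ::
  "(nat \<Rightarrow> 'a metric) \<Rightarrow> (nat \<Rightarrow> 'a \<Rightarrow> 'a) \<Rightarrow> 'a measure \<Rightarrow> (nat \<Rightarrow> 'a \<Rightarrow> real) \<Rightarrow> 'a \<Rightarrow> ereal" where
  "lower_local_pressure X T \<mu> f x =
     Lim (at_right (0::real)) (\<lambda>\<epsilon>.
       liminf (\<lambda>n. (- log_ereal (measure \<mu> (bowen_ball X T n x \<epsilon>)) + ereal (birkhoff_sum T f n x))
                    / ereal (real n)))"

text \<open>
  A countable family of Bowen balls is given by its orders \<open>n i\<close> and centres \<open>x i\<close> for \<open>i\<close> in an
  index set \<open>I\<close> of natural numbers (finite or infinite).
\<close>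

definition bowen_cover ::
  "(nat \<Rightarrow> 'a metric) \<Rightarrow> (nat \<Rightarrow> 'a \<Rightarrow> 'a) \<Rightarrow> nat \<Rightarrow> real \<Rightarrow> 'a set \<Rightarrow>
   nat set \<Rightarrow> (nat \<Rightarrow> nat) \<Rightarrow> (nat \<Rightarrow> 'a) \<Rightarrow> bool" where
  "bowen_cover X T N \<epsilon> Z I n x \<longleftrightarrow>
     (\<forall>i\<in>I. x i \<in> mspace (X 0) \<and> N \<le> n i) \<and> Z \<subseteq> (\<Union>i\<in>I. bowen_ball X T (n i) (x i) \<epsilon>)"

definition bowen_R_N ::
  "(nat \<Rightarrow> 'a metric) \<Rightarrow> (nat \<Rightarrow> 'a \<Rightarrow> 'a) \<Rightarrow> (nat \<Rightarrow> 'a \<Rightarrow> real) \<Rightarrow> 'a set \<Rightarrow>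
   nat \<Rightarrow> real \<Rightarrow> real \<Rightarrow> ennreal" where
  "bowen_R_N X T f Z N \<epsilon> s =
     (INF (I, n, x) \<in> {(I, n, x). bowen_cover X T N \<epsilon> Z I n x}.
        \<Sum>\<^sub>\<infinity>i\<in>I. ennreal (exp (- real (n i) * s + birkhoff_sum T f (n i) (x i))))"

definition bowen_R ::
  "(nat \<Rightarrow> 'a metric) \<Rightarrow> (nat \<Rightarrow> 'a \<Rightarrow> 'a) \<Rightarrow> (nat \<Rightarrow> 'a \<Rightarrow> real) \<Rightarrow> 'a set \<Rightarrow>
   real \<Rightarrow> real \<Rightarrow> ennreal" where
  "bowen_R X T f Z \<epsilon> s = lim (\<lambda>N. bowen_R_N X T f Z N \<epsilon> s)"

text \<open>The infimum is taken in the extended reals, so it is \<open>\<infinity>\<close> if no \<open>s\<close> qualifies.\<close>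

definition bowen_pressure_at ::
  "(nat \<Rightarrow> 'a metric) \<Rightarrow> (nat \<Rightarrow> 'a \<Rightarrow> 'a) \<Rightarrow> (nat \<Rightarrow> 'a \<Rightarrow> real) \<Rightarrow> 'a set \<Rightarrow> real \<Rightarrow> ereal" where
  "bowen_pressure_at X T f Z \<epsilon> = Inf (ereal ` {s. bowen_R X T f Z \<epsilon> s = 0})"

definition bowen_pressure ::
  "(nat \<Rightarrow> 'a metric) \<Rightarrow> (nat \<Rightarrow> 'a \<Rightarrow> 'a) \<Rightarrow> (nat \<Rightarrow> 'a \<Rightarrow> real) \<Rightarrow> 'a set \<Rightarrow> ereal" where
  "bowen_pressure X T f Z = Lim (at_right (0::real)) (bowen_pressure_at X T f Z)"

end

theory Submission
  imports Defs
begin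

text \<open>
  (1) For \<open>\<beta> > s\<close> every point of \<open>E\<close> has arbitrarily long Bowen balls with
  \<open>\<mu>(B\<^sub>n(x,\<epsilon>)) \<ge> exp(-n\<beta> + S\<^sub>n f(x))\<close>. A Vitali-type selection, preferring small \<open>n\<close>, extracts a
  disjoint subfamily whose enlargements to radius \<open>2\<epsilon>\<close> still cover \<open>E\<close>; disjointness bounds the sum
  of the weights by \<open>1\<close>.

  (2) \<open>E\<close> is the union of the sets \<open>E\<^sub>k\<close> of points with
  \<open>\<mu>(B\<^sub>n(x,1/k)) \<le> exp(-n(s-\<eta>) + S\<^sub>n f(x))\<close> for all \<open>n \<ge> k\<close>. If the pressure of \<open>E\<close> were below \<open>s-2\<eta>\<close>,
  covers of small total weight by fine Bowen balls would exist; recentring the balls that meet \<open>E\<^sub>k\<close>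
  at points of \<open>E\<^sub>k\<close> costs only a factor \<open>exp(n\<eta>)\<close> by equicontinuity, so each \<open>E\<^sub>k\<close> would be
  negligible, whence \<open>\<mu>(E) = 0\<close>.
\<close>

section \<open>Tools: monotone limits, disjoint selection, null supersets, countable sums\<close>

lemma Lim_at_right_0_antimono:
  fixes g :: "real \<Rightarrow> ereal"
  assumes "\<And>a b. 0 < a \<Longrightarrow> a \<le> b \<Longrightarrow> g b \<le> g a"
  shows "Lim (at_right 0) g = (SUP e\<in>{0<..}. g e)"
proof (rule tendsto_Lim)
  show "(g \<longlongrightarrow> (SUP e\<in>{0<..}. g e)) (at_right 0)"
  proof (rule order_tendstoI)
    fix a assume "a < (SUP e\<in>{0<..}. g e)"
    then obtain e where e: "e > 0" "a < g e" by (auto simp: less_SUP_iff)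
    have "a < g x" if "0 < x" "x < e" for x
      using assms[of x e] that e by (meson less_imp_le less_le_trans)
    then show "\<forall>\<^sub>F x in at_right 0. a < g x"
      using e(1) by (auto simp: eventually_at_right_field)
  next
    fix a assume a: "(SUP e\<in>{0<..}. g e) < a"
    have "g x < a" if "x > 0" for x
      using SUP_upper[of x "{0<..}" g] that a by (auto intro: le_less_trans)
    then show "\<forall>\<^sub>F x in at_right 0. g x < a"
      by (auto simp: eventually_at_right_field intro: exI[of _ 1])
  qed
qed simp

text \<open>Greedy choice by well-founded recursion, so \<open>A\<close> may be uncountable: an
  index is accepted iff its set misses all sets accepted earlier. A rejected index is blocked by an
  accepted predecessor, and an accepted one serves as its own witness because its set is
  nonempty.\<close>

lemma exists_greedy_disjoint_subfamily:
  fixes B :: "'a \<Rightarrow> 'b set" and n :: "'a \<Rightarrow> nat"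
  assumes ne: "\<And>x. x \<in> A \<Longrightarrow> B x \<noteq> {}"
  obtains S where "S \<subseteq> A" "disjoint_family_on B S"
    "\<And>x. x \<in> A \<Longrightarrow> \<exists>y\<in>S. n y \<le> n x \<and> B x \<inter> B y \<noteq> {}"
proof -
  obtain w :: "'a rel" where w: "Well_order w" "Field w = UNIV"
    using well_ordering[where 'a = 'a] by (elim exE conjE)
  have wfw: "wf (w - Id)" and tot: "total w"
    using w unfolding well_order_on_def linear_order_on_def by simp_all
  \<comment> \<open>Comparing \<open>n\<close> first forces a blocking index to have
    \<open>n y \<le> n x\<close>; the well-order only breaks ties.\<close>
  define r where "r = inv_image (less_than <*lex*> (w - Id)) (\<lambda>x. (n x, x))"
  have wfr: "wf r"
    unfolding r_def by (rule wf_inv_image[OF wf_lex_prod[OF wf_less_than wfw]])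
  define H where "H g x \<longleftrightarrow> x \<in> A \<and> \<not> (\<exists>y. (y, x) \<in> r \<and> g y \<and> B x \<inter> B y \<noteq> {})" for g x
  define P where "P = wfrec r H"
  have "P x = H (cut P r x) x" for x
    unfolding P_def by (rule wfrec[OF wfr])
  \<comment> \<open>\<open>H\<close> consults its function argument only at
    \<open>r\<close>-predecessors of \<open>x\<close>, where \<open>cut P r x\<close> agrees with
    \<open>P\<close>.\<close>
  then have P: "P x \<longleftrightarrow> x \<in> A \<and> \<not> (\<exists>y. (y, x) \<in> r \<and> P y \<and> B x \<inter> B y \<noteq> {})" for x
    unfolding H_def cut_def by (metis (full_types))
  show ?thesis
  proof (rule that[of "{x. P x}"])
    show "{x. P x} \<subseteq> A" using P by blast
    show "disjoint_family_on B {x. P x}"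
      unfolding disjoint_family_on_def
    proof (intro ballI impI)
      fix x y assume xy: "x \<in> {x. P x}" "y \<in> {x. P x}" "x \<noteq> y"
      then have "(x, y) \<in> w \<or> (y, x) \<in> w" using tot by (auto simp: total_on_def)
      then have "(x, y) \<in> r \<or> (y, x) \<in> r"
        using xy(3) by (auto simp: r_def)
      then show "B x \<inter> B y = {}" using P[of x] P[of y] xy by blast
    qed
    show "\<exists>y\<in>{x. P x}. n y \<le> n x \<and> B x \<inter> B y \<noteq> {}" if xA: "x \<in> A" for x
    proof (cases "P x")
      case True
      then show ?thesis using ne[OF xA] by auto
    next
      case False
      then obtain y where "(y, x) \<in> r" "P y" "B x \<inter> B y \<noteq> {}" using P[of x] xA by blast
      then show ?thesis by (auto simp: r_def intro!: exI[of _ y])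
    qed
  qed
qed

text \<open>\<open>A\<close> may be non-measurable, so its negligibility is expressed by a
  measurable superset: the intersection of supersets of measure at most 1/(m+1).\<close>

lemma exists_null_superset:
  assumes "\<And>\<delta>::real. \<delta> > 0 \<Longrightarrow> \<exists>U\<in>sets M. A \<subseteq> U \<and> emeasure M U \<le> ennreal \<delta>"
  shows "\<exists>U\<in>null_sets M. A \<subseteq> U"
proof -
  have "\<exists>U. U \<in> sets M \<and> A \<subseteq> U \<and> emeasure M U \<le> ennreal (1 / real (Suc m))" for m :: nat
    using assms[of "1 / real (Suc m)"] by auto
  then obtain U where U: "\<And>m::nat. U m \<in> sets M" "\<And>m. A \<subseteq> U m"
      "\<And>m. emeasure M (U m) \<le> ennreal (1 / real (Suc m))"
    by metis
  have "emeasure M (\<Inter>m. U m) \<le> ennreal (1 / real (Suc m))" for m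
    by (rule order_trans[OF emeasure_mono U(3)]) (use U(1) in auto)
  moreover have "(\<lambda>m. ennreal (1 / real (Suc m))) \<longlonglongrightarrow> ennreal 0"
    by (intro tendsto_ennrealI LIMSEQ_Suc lim_1_over_n)
  ultimately have "emeasure M (\<Inter>m. U m) \<le> ennreal 0"
    by (intro LIMSEQ_le_const[where a = "emeasure M _"]) auto
  then have "(\<Inter>m. U m) \<in> null_sets M"
    using U(1) by (intro null_setsI) auto
  then show ?thesis using U(2) by (intro bexI[of _ "\<Inter>m. U m"]) auto
qed

lemma emeasure_UN_le_infsum:
  fixes B :: "nat \<Rightarrow> 'a set"
  assumes "\<And>i. i \<in> J \<Longrightarrow> B i \<in> sets M" "J \<subseteq> I"
    and "\<And>i. i \<in> J \<Longrightarrow> emeasure M (B i) \<le> h i"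
  shows "emeasure M (\<Union>i\<in>J. B i) \<le> (\<Sum>\<^sub>\<infinity>i\<in>I. h i)"
proof -
  \<comment> \<open>Padding with empty sets makes the family run over all naturals, as countable
    subadditivity requires.\<close>
  define g where "g i = (if i \<in> J then B i else {})" for i
  have g: "range g \<subseteq> sets M" using assms(1) by (auto simp: g_def)
  have "(\<Union>i\<in>J. B i) = (\<Union>i. g i)" by (auto simp: g_def)
  then have "emeasure M (\<Union>i\<in>J. B i) \<le> (\<Sum>i. emeasure M (g i))"
    using emeasure_subadditive_countably[OF g] by simp
  also have "\<dots> = (\<Sum>\<^sub>\<infinity>i. emeasure M (g i))"
    by (rule sums_unique[symmetric, OF has_sum_imp_sums]) (simp add: nonneg_summable_on_complete)
  also have "\<dots> = (\<Sum>\<^sub>\<infinity>i\<in>J. emeasure M (B i))"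
    by (rule infsum_cong_neutral) (auto simp: g_def)
  also have "\<dots> \<le> (\<Sum>\<^sub>\<infinity>i\<in>J. h i)"
    by (rule infsum_mono) (auto simp: nonneg_summable_on_complete assms(3))
  also have "\<dots> \<le> (\<Sum>\<^sub>\<infinity>i\<in>I. h i)"
    by (rule infsum_mono_neutral) (use assms(2) in \<open>auto simp: nonneg_summable_on_complete\<close>)
  finally show ?thesis .
qed

section \<open>Bowen balls and covers: monotonicity in radius and order\<close>

lemma in_bowen_ball_iff:
  "y \<in> bowen_ball X T n x \<epsilon> \<longleftrightarrow>
    y \<in> mspace (X 0) \<and> (\<forall>j\<le>n - 1. mdist (X j) (nds_iter T j x) (nds_iter T j y) < \<epsilon>)"
  by (auto simp: bowen_ball_def bowen_dist_def)

lemma bowen_ball_mono: "\<epsilon> \<le> \<epsilon>' \<Longrightarrow> bowen_ball X T n x \<epsilon> \<subseteq> bowen_ball X T n x \<epsilon>'"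
  by (force simp: in_bowen_ball_iff)

lemma bowen_ball_antimono: "n \<le> m \<Longrightarrow> bowen_ball X T m x \<epsilon> \<subseteq> bowen_ball X T n x \<epsilon>"
  by (auto simp: in_bowen_ball_iff)

lemma bowen_cover_mono_radius:
  assumes "\<epsilon> \<le> \<epsilon>'" "bowen_cover X T N \<epsilon> Z I n x"
  shows "bowen_cover X T N \<epsilon>' Z I n x"
proof -
  have "(\<Union>i\<in>I. bowen_ball X T (n i) (x i) \<epsilon>) \<subseteq> (\<Union>i\<in>I. bowen_ball X T (n i) (x i) \<epsilon>')"
    by (intro UN_mono subset_refl bowen_ball_mono assms(1))
  then show ?thesis
    using assms(2) unfolding bowen_cover_def by (blast intro: subset_trans)
qed

lemma bowen_cover_antimono_order:
  assumes "M \<le> N" "bowen_cover X T N \<epsilon> Z I n x"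
  shows "bowen_cover X T M \<epsilon> Z I n x"
  using assms unfolding bowen_cover_def by (meson order_trans)

text \<open>The weight of a cover depends only on its orders and centres, so a larger radius merely
  enlarges the set of data over which the infimum runs.\<close>

lemma bowen_R_N_antimono_radius:
  "\<epsilon> \<le> \<epsilon>' \<Longrightarrow> bowen_R_N X T f Z N \<epsilon>' s \<le> bowen_R_N X T f Z N \<epsilon> s"
  unfolding bowen_R_N_def
  by (intro INF_superset_mono Collect_mono) (use bowen_cover_mono_radius[of \<epsilon> \<epsilon>' X T N Z] in auto)

lemma bowen_R_N_mono_order:
  "M \<le> N \<Longrightarrow> bowen_R_N X T f Z M \<epsilon> s \<le> bowen_R_N X T f Z N \<epsilon> s"
  unfolding bowen_R_N_def
  by (intro INF_superset_mono Collect_mono) (use bowen_cover_antimono_order[of M N X T \<epsilon> Z] in auto)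

text \<open>Raising \<open>N\<close> leaves fewer covers, so the sequence is increasing and its
  limit is the supremum.\<close>

lemma bowen_R_eq_SUP: "bowen_R X T f Z \<epsilon> s = (SUP N. bowen_R_N X T f Z N \<epsilon> s)"
  unfolding bowen_R_def
  by (intro limI LIMSEQ_SUP) (simp add: incseq_def bowen_R_N_mono_order)

lemma bowen_pressure_at_antimono:
  assumes "\<epsilon> \<le> \<epsilon>'"
  shows "bowen_pressure_at X T f Z \<epsilon>' \<le> bowen_pressure_at X T f Z \<epsilon>"
proof -
  have "bowen_R X T f Z \<epsilon>' s \<le> bowen_R X T f Z \<epsilon> s" for s
    unfolding bowen_R_eq_SUP by (intro SUP_mono') (rule bowen_R_N_antimono_radius[OF assms])
  then have "{s. bowen_R X T f Z \<epsilon> s = 0} \<subseteq> {s. bowen_R X T f Z \<epsilon>' s = 0}"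
    by (auto simp: order_antisym) (metis le_zero_eq)
  then show ?thesis
    unfolding bowen_pressure_at_def by (intro Inf_superset_mono image_mono)
qed

lemma bowen_pressure_eq_SUP: "bowen_pressure X T f Z = (SUP \<epsilon>\<in>{0<..}. bowen_pressure_at X T f Z \<epsilon>)"
  unfolding bowen_pressure_def by (rule Lim_at_right_0_antimono) (rule bowen_pressure_at_antimono)

section \<open>Bowen balls of a nonautonomous system: triangle inequality and openness\<close>

context
  fixes X :: "nat \<Rightarrow> 'a metric" and T :: "nat \<Rightarrow> 'a \<Rightarrow> 'a"
  assumes nds: "nds X T"
begin

lemma continuous_map_nds_iter:
  "continuous_map (mtopology_of (X 0)) (mtopology_of (X j)) (nds_iter T j)"
proof (induction j)
  case (Suc j)
  then show ?case
    unfolding nds_iter.simps(2) by (rule continuous_map_compose) (use nds in \<open>simp add: nds_def\<close>)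
qed simp

lemma nds_iter_in_mspace: "x \<in> mspace (X 0) \<Longrightarrow> nds_iter T j x \<in> mspace (X j)"
  using continuous_map_image_subset_topspace[OF continuous_map_nds_iter[of j]] by auto

lemma center_in_bowen_ball: "x \<in> mspace (X 0) \<Longrightarrow> 0 < \<epsilon> \<Longrightarrow> x \<in> bowen_ball X T n x \<epsilon>"
  using Metric_space.mdist_zero[OF Metric_space_mspace_mdist nds_iter_in_mspace]
  by (simp add: in_bowen_ball_iff)

lemma bowen_ball_sym:
  "x \<in> mspace (X 0) \<Longrightarrow> y \<in> bowen_ball X T n x \<epsilon> \<Longrightarrow> x \<in> bowen_ball X T n y \<epsilon>"
  by (simp add: in_bowen_ball_iff mdist_commute)

lemma bowen_ball_triangle:
  assumes x: "x \<in> mspace (X 0)" and y: "y \<in> bowen_ball X T n x a" and z: "z \<in> bowen_ball X T n y b"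
  shows "z \<in> bowen_ball X T n x (a + b)"
proof -
  have "mdist (X j) (nds_iter T j x) (nds_iter T j z) < a + b" if "j \<le> n - 1" for j
  proof -
    have "mdist (X j) (nds_iter T j x) (nds_iter T j z)
      \<le> mdist (X j) (nds_iter T j x) (nds_iter T j y) + mdist (X j) (nds_iter T j y) (nds_iter T j z)"
      using x y z by (intro mdist_triangle nds_iter_in_mspace) (auto simp: in_bowen_ball_iff)
    then show ?thesis using y z that by (fastforce simp: in_bowen_ball_iff)
  qed
  then show ?thesis using z by (simp add: in_bowen_ball_iff)
qed

text \<open>The ball is a finite intersection of preimages of metric balls under the continuous
  iterates.\<close>

lemma openin_bowen_ball:
  assumes "x \<in> mspace (X 0)"
  shows "openin (mtopology_of (X 0)) (bowen_ball X T n x \<epsilon>)"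
proof -
  have "bowen_ball X T n x \<epsilon> = (\<Inter>j\<in>{..n - 1}.
      {y \<in> topspace (mtopology_of (X 0)). nds_iter T j y \<in> mball_of (X j) (nds_iter T j x) \<epsilon>})"
    using assms by (auto simp: in_bowen_ball_iff nds_iter_in_mspace)
  moreover have "openin (mtopology_of (X 0)) \<dots>"
    by (intro openin_INT2 openin_continuous_map_preimage[OF continuous_map_nds_iter])
       (auto simp: mtopology_of_def mball_of_def Metric_space.openin_mball)
  ultimately show ?thesis by simp
qed

lemma bowen_ball_in_metric_borel:
  "x \<in> mspace (X 0) \<Longrightarrow> bowen_ball X T n x \<epsilon> \<in> sets (metric_borel (X 0))"
proof -
  assume "x \<in> mspace (X 0)"
  moreover have "{U. openin (mtopology_of (X 0)) U} \<subseteq> Pow (mspace (X 0))"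
    using openin_subset by fastforce
  ultimately show ?thesis
    by (auto simp: metric_borel_def intro!: openin_bowen_ball)
qed

end

section \<open>Logarithmic mass rates and re-indexing of covers\<close>

abbreviation log_mass_rate ::
  "(nat \<Rightarrow> 'a metric) \<Rightarrow> (nat \<Rightarrow> 'a \<Rightarrow> 'a) \<Rightarrow> 'a measure \<Rightarrow> (nat \<Rightarrow> 'a \<Rightarrow> real) \<Rightarrow> 'a \<Rightarrow> real \<Rightarrow> nat \<Rightarrow> ereal"
  where "log_mass_rate X T \<mu> f x \<epsilon> n \<equiv>
    (- log_ereal (measure \<mu> (bowen_ball X T n x \<epsilon>)) + ereal (birkhoff_sum T f n x)) / ereal (real n)"

text \<open>For \<open>p > 0\<close> this is taking logarithms. For \<open>p = 0\<close> the rate is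
  \<infinity> and the exponential is positive, so both sides fail.\<close>

lemma log_rate_less_iff:
  assumes "0 < n" "0 \<le> p"
  shows "(- log_ereal p + ereal S) / ereal (real n) < ereal b \<longleftrightarrow> exp (- real n * b + S) < p"
proof (cases "p = 0")
  case False
  then have "p > 0" using assms by simp
  have "(- log_ereal p + ereal S) / ereal (real n) < ereal b \<longleftrightarrow> - real n * b + S < ln p"
    using assms False by (simp add: log_ereal_def field_simps)
  also have "\<dots> \<longleftrightarrow> exp (- real n * b + S) < p"
    using \<open>p > 0\<close> by (metis exp_less_cancel_iff exp_ln)
  finally show ?thesis .
qed (use assms in \<open>auto simp: log_ereal_def\<close>)


lemma log_rate_antimono:
  assumes "0 \<le> p" "p \<le> q"
  shows "(- log_ereal q + ereal S) / ereal (real n) \<le> (- log_ereal p + ereal S) / ereal (real n)"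
proof -
  have "log_ereal p \<le> log_ereal q" using assms by (auto simp: log_ereal_def)
  then show ?thesis
    unfolding divide_ereal_def
    by (intro ereal_mult_right_mono add_right_mono) (auto simp: ereal_inverse_nonneg_iff)
qed

lemma infsum_ennreal_le:
  assumes "\<And>F. finite F \<Longrightarrow> F \<subseteq> A \<Longrightarrow> (\<Sum>x\<in>F. h x) \<le> (c::ennreal)"
  shows "(\<Sum>\<^sub>\<infinity>x\<in>A. h x) \<le> c"
  by (subst nonneg_infsum_complete) (auto intro!: SUP_least assms)

text \<open>Covers are defined with sets of naturals as indices, while the selection argument yields
  a countable set of centres; \<open>to_nat_on\<close> carries one indexing to the other.\<close>

lemma bowen_R_N_le_infsum:
  assumes "countable S" "S \<subseteq> mspace (X 0)" "\<And>y. y \<in> S \<Longrightarrow> N \<le> m y"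
    and cover: "Z \<subseteq> (\<Union>y\<in>S. bowen_ball X T (m y) y \<epsilon>)"
  shows "bowen_R_N X T f Z N \<epsilon> s \<le>
    (\<Sum>\<^sub>\<infinity>y\<in>S. ennreal (exp (- real (m y) * s + birkhoff_sum T f (m y) y)))"
proof -
  define I where "I = to_nat_on S ` S"
  define x where "x = inv_into S (to_nat_on S)"
  have bij: "bij_betw x I S"
    unfolding x_def I_def
    by (intro bij_betw_inv_into) (auto simp: bij_betw_def assms(1) inj_on_to_nat_on)
  then have "x ` I = S" by (simp add: bij_betw_def)
  then have cov: "bowen_cover X T N \<epsilon> Z I (m \<circ> x) x"
    using assms(2,3) cover unfolding bowen_cover_def by auto
  have "bowen_R_N X T f Z N \<epsilon> s \<le>
      (\<Sum>\<^sub>\<infinity>i\<in>I. ennreal (exp (- real (m (x i)) * s + birkhoff_sum T f (m (x i)) (x i))))"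
    unfolding bowen_R_N_def by (rule INF_lower2[of "(I, m \<circ> x, x)"]) (use cov in auto)
  also have "\<dots> = (\<Sum>\<^sub>\<infinity>y\<in>S. ennreal (exp (- real (m y) * s + birkhoff_sum T f (m y) y)))"
    by (rule infsum_reindex_bij_betw[OF bij])
  finally show ?thesis .
qed

section \<open>A Borel probability measure on the initial space\<close>

locale nds_prob_space = prob_space \<mu> for \<mu> :: "'a measure" +
  fixes X :: "nat \<Rightarrow> 'a metric" and T :: "nat \<Rightarrow> 'a \<Rightarrow> 'a" and f :: "nat \<Rightarrow> 'a \<Rightarrow> real"
  assumes nds: "nds X T" and sets_eq: "sets \<mu> = sets (metric_borel (X 0))"
begin

lemma events_subset_mspace: "E \<in> events \<Longrightarrow> E \<subseteq> mspace (X 0)"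
  using sets.sets_into_space[of E \<mu>] sets_eq_imp_space_eq[OF sets_eq]
  by (simp add: metric_borel_def space_measure_of_conv)

lemma bowen_ball_measurable: "x \<in> mspace (X 0) \<Longrightarrow> bowen_ball X T n x \<epsilon> \<in> events"
  using bowen_ball_in_metric_borel[OF nds] sets_eq by simp

lemma lower_local_pressure_eq_SUP:
  assumes "x \<in> mspace (X 0)"
  shows "lower_local_pressure X T \<mu> f x = (SUP \<epsilon>\<in>{0<..}. liminf (log_mass_rate X T \<mu> f x \<epsilon>))"
  unfolding lower_local_pressure_def
proof (rule Lim_at_right_0_antimono)
  fix a b :: real assume "a \<le> b"
  then show "liminf (log_mass_rate X T \<mu> f x b) \<le> liminf (log_mass_rate X T \<mu> f x a)"
    by (intro Liminf_mono always_eventually allI log_rate_antimono finite_measure_mono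
        bowen_ball_mono bowen_ball_measurable assms measure_nonneg)
qed

section \<open>Upper bound for the Bowen pressure\<close>

lemma disjoint_sum_prob_le_1:
  assumes "finite F" "disjoint_family_on B F" "\<And>x. x \<in> F \<Longrightarrow> B x \<in> events"
  shows "(\<Sum>x\<in>F. prob (B x)) \<le> 1"
  using finite_measure_finite_Union[OF assms(1) _ assms(2)] assms(3) prob_le_1[of "\<Union>(B ` F)"]
  by (auto simp: image_subset_iff)

text \<open>Finite partial sums of the probabilities are at most 1, so the family is summable and
  has countable support. This makes a greedily selected family admissible as a Bowen cover.\<close>

lemma countable_disjoint_positive_prob:
  assumes "disjoint_family_on B S" "\<And>x. x \<in> S \<Longrightarrow> B x \<in> events" "\<And>x. x \<in> S \<Longrightarrow> 0 < prob (B x)"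
  shows "countable S"
proof -
  have "(\<lambda>x. prob (B x)) summable_on S"
  proof (rule nonneg_bdd_above_summable_on)
    have "(\<Sum>x\<in>F. prob (B x)) \<le> 1" if "F \<subseteq> S" "finite F" for F
      using that assms(2) disjoint_family_on_mono[OF that(1) assms(1)]
      by (intro disjoint_sum_prob_le_1) auto
    then show "bdd_above (sum (\<lambda>x. prob (B x)) ` {F. F \<subseteq> S \<and> finite F})"
      by (auto intro: bdd_aboveI[of _ 1])
  qed auto
  then have "countable {x\<in>S. prob (B x) \<noteq> 0}" by (rule summable_countable_real)
  moreover have "{x\<in>S. prob (B x) \<noteq> 0} = S" using assms(3) by force
  ultimately show ?thesis by simp
qed

text \<open>Passing from \<beta> to \<open>s\<close> gains a factor of at most exp(-N(s-\<beta>))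
  per selected ball, since its order is at least \<open>N\<close>; the remaining weight is below the
  mass of the ball, and disjoint masses sum to at most 1.\<close>

lemma bowen_R_N_le_of_heavy_balls:
  assumes E: "E \<subseteq> mspace (X 0)" and \<epsilon>: "0 < \<epsilon>" and "\<beta> \<le> s"
    and heavy: "\<And>x. x \<in> E \<Longrightarrow>
      \<exists>n\<ge>N. exp (- real n * \<beta> + birkhoff_sum T f n x) < prob (bowen_ball X T n x \<epsilon>)"
  shows "bowen_R_N X T f E N (2 * \<epsilon>) s \<le> ennreal (exp (- real N * (s - \<beta>)))"
proof -
  obtain m where m: "\<And>x. x \<in> E \<Longrightarrow> N \<le> m x"
      "\<And>x. x \<in> E \<Longrightarrow> exp (- real (m x) * \<beta> + birkhoff_sum T f (m x) x)
          < prob (bowen_ball X T (m x) x \<epsilon>)"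
    using heavy by metis
  define B where "B x = bowen_ball X T (m x) x \<epsilon>" for x
  obtain S where S: "S \<subseteq> E" "disjoint_family_on B S"
      "\<And>x. x \<in> E \<Longrightarrow> \<exists>y\<in>S. m y \<le> m x \<and> B x \<inter> B y \<noteq> {}"
  proof (rule exists_greedy_disjoint_subfamily[of E B m])
    show "B x \<noteq> {}" if "x \<in> E" for x
      using center_in_bowen_ball[OF nds _ \<epsilon>] that E unfolding B_def by blast
  qed blast
  have SX: "S \<subseteq> mspace (X 0)" using S(1) E by blast
  have meas: "B x \<in> events" if "x \<in> S" for x
    using bowen_ball_measurable SX that by (auto simp: B_def)
  have "0 < prob (B x)" if "x \<in> S" for x
    unfolding B_def by (rule less_trans[OF exp_gt_zero m(2)]) (use that S(1) in auto)
  then have "countable S"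
    using countable_disjoint_positive_prob[OF S(2) meas] by blast
  moreover have "E \<subseteq> (\<Union>y\<in>S. bowen_ball X T (m y) y (2 * \<epsilon>))"
  proof
    fix x assume x: "x \<in> E"
    then obtain y z where y: "y \<in> S" "m y \<le> m x" and z: "z \<in> B x" "z \<in> B y"
      using S(3) by blast
    \<comment> \<open>Since \<open>m y \<le> m x\<close>, the ball around \<open>x\<close> may be
      relaxed to order \<open>m y\<close>. Both balls then have the same order and the triangle
      inequality applies.\<close>
    have "z \<in> bowen_ball X T (m y) x \<epsilon>"
      using z(1) bowen_ball_antimono[OF y(2), of X T x \<epsilon>] unfolding B_def by blast
    then have "x \<in> bowen_ball X T (m y) y (\<epsilon> + \<epsilon>)"
      using x y E SX z(2) unfolding B_def
      by (intro bowen_ball_triangle[OF nds _ _ bowen_ball_sym[OF nds]]) auto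
    then show "x \<in> (\<Union>y\<in>S. bowen_ball X T (m y) y (2 * \<epsilon>))" using y(1) by auto
  qed
  ultimately have "bowen_R_N X T f E N (2 * \<epsilon>) s \<le>
      (\<Sum>\<^sub>\<infinity>y\<in>S. ennreal (exp (- real (m y) * s + birkhoff_sum T f (m y) y)))"
    using SX S(1) m(1) by (intro bowen_R_N_le_infsum) auto
  also have "\<dots> \<le> ennreal (exp (- real N * (s - \<beta>)))"
  proof (rule infsum_ennreal_le)
    fix F assume F: "finite F" "F \<subseteq> S"
    have "exp (- real (m y) * s + birkhoff_sum T f (m y) y) \<le> exp (- real N * (s - \<beta>)) * prob (B y)"
      if "y \<in> F" for y
    proof -
      have y: "y \<in> E" using that F S by blast
      have "real N * (s - \<beta>) \<le> real (m y) * (s - \<beta>)"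
        using m(1)[OF y] \<open>\<beta> \<le> s\<close> by (intro mult_right_mono) auto
      then have "exp (- real (m y) * s + birkhoff_sum T f (m y) y)
          \<le> exp (- real N * (s - \<beta>) + (- real (m y) * \<beta> + birkhoff_sum T f (m y) y))"
        by (simp add: algebra_simps)
      also have "\<dots> \<le> exp (- real N * (s - \<beta>)) * prob (B y)"
        unfolding exp_add[of "- real N * (s - \<beta>)"] B_def
        using m(2)[OF y] by (intro mult_left_mono) auto
      finally show ?thesis .
    qed
    then have "(\<Sum>y\<in>F. exp (- real (m y) * s + birkhoff_sum T f (m y) y))
        \<le> exp (- real N * (s - \<beta>)) * (\<Sum>y\<in>F. prob (B y))"
      unfolding sum_distrib_left by (rule sum_mono)
    also have "\<dots> \<le> exp (- real N * (s - \<beta>)) * 1"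
      using F meas disjoint_family_on_mono[OF F(2) S(2)]
      by (intro mult_left_mono disjoint_sum_prob_le_1) auto
    finally show "(\<Sum>y\<in>F. ennreal (exp (- real (m y) * s + birkhoff_sum T f (m y) y)))
        \<le> ennreal (exp (- real N * (s - \<beta>)))"
      by (simp add: sum_ennreal ennreal_leI)
  qed
  finally show ?thesis .
qed

lemma exists_heavy_balls:
  assumes x: "x \<in> mspace (X 0)" and less: "lower_local_pressure X T \<mu> f x < ereal \<beta>" and \<epsilon>: "0 < \<epsilon>"
  shows "\<exists>n\<ge>N. exp (- real n * \<beta> + birkhoff_sum T f n x) < prob (bowen_ball X T n x \<epsilon>)"
proof (rule ccontr)
  assume neg: "\<not> ?thesis"
  \<comment> \<open>Starting at \<open>Suc N\<close> keeps \<open>n\<close> positive, as the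
    logarithmic translation demands.\<close>
  have "ereal \<beta> \<le> log_mass_rate X T \<mu> f x \<epsilon> n" if "n \<ge> Suc N" for n
    using neg that log_rate_less_iff[of n] by (meson Suc_leD le_eq_less_or_eq less_le_trans linorder_not_less measure_nonneg zero_less_Suc)
  then have "ereal \<beta> \<le> liminf (log_mass_rate X T \<mu> f x \<epsilon>)"
    by (intro Liminf_bounded) (auto simp: eventually_sequentially)
  also have "\<dots> \<le> lower_local_pressure X T \<mu> f x"
    unfolding lower_local_pressure_eq_SUP[OF x] by (rule SUP_upper) (use \<epsilon> in auto)
  finally show False using less by simp
qed

lemma bowen_pressure_le:
  assumes E: "E \<subseteq> mspace (X 0)" and le: "\<And>x. x \<in> E \<Longrightarrow> lower_local_pressure X T \<mu> f x \<le> ereal s"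
  shows "bowen_pressure X T f E \<le> ereal s"
proof -
  have *: "bowen_R X T f E \<epsilon> t = 0" if \<epsilon>: "0 < \<epsilon>" and t: "s < t" for \<epsilon> t
  proof -
    \<comment> \<open>A value strictly between: above \<open>s\<close>, so that heavy balls exist at
      rate \<beta>, and below \<open>t\<close>, so that the bound decays geometrically in
      \<open>N\<close>.\<close>
    define \<beta> where "\<beta> = (s + t) / 2"
    have \<beta>: "s < \<beta>" "\<beta> < t" using t by (auto simp: \<beta>_def)
    have "lower_local_pressure X T \<mu> f x < ereal \<beta>" if "x \<in> E" for x
      using le[OF that] \<beta>(1) by (meson ereal_less_eq(3) less_ereal.simps(1) le_less_trans)
    then have "bowen_R_N X T f E N (2 * (\<epsilon> / 2)) t \<le> ennreal (exp (- real N * (t - \<beta>)))" for N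
      using E \<epsilon> \<beta> by (intro bowen_R_N_le_of_heavy_balls exists_heavy_balls) auto
    moreover have "exp (- real N * (t - \<beta>)) = exp (- (t - \<beta>)) ^ N" for N
      by (simp add: exp_of_nat_mult[symmetric] algebra_simps)
    ultimately have le: "bowen_R_N X T f E N \<epsilon> t \<le> ennreal (exp (- (t - \<beta>)) ^ N)" for N
      by (metis field_sum_of_halves mult_2)
    have "(\<lambda>N. ennreal (exp (- (t - \<beta>)) ^ N)) \<longlonglongrightarrow> ennreal 0"
      using \<beta> by (intro tendsto_ennrealI LIMSEQ_power_zero) auto
    moreover have "(\<lambda>N. bowen_R_N X T f E N \<epsilon> t) \<longlonglongrightarrow> bowen_R X T f E \<epsilon> t"
      unfolding bowen_R_eq_SUP by (intro LIMSEQ_SUP) (simp add: incseq_def bowen_R_N_mono_order)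
    ultimately have "bowen_R X T f E \<epsilon> t \<le> ennreal 0"
      using le by (intro LIMSEQ_le) auto
    then show ?thesis by simp
  qed
  have "bowen_pressure_at X T f E \<epsilon> \<le> ereal s" if \<epsilon>: "0 < \<epsilon>" for \<epsilon>
  proof (rule ccontr)
    assume "\<not> ?thesis"
    \<comment> \<open>Such a \<open>t\<close> exceeds \<open>s\<close>, so \<open>bowen_R\<close>
      vanishes there and the infimum defining the pressure cannot exceed \<open>t\<close>.\<close>
    then obtain t where t: "ereal s < ereal t" "ereal t < bowen_pressure_at X T f E \<epsilon>"
      using ereal_dense2 by (metis not_le)
    then show False
      using *[OF \<epsilon>, of t] INF_lower[of t "{s. bowen_R X T f E \<epsilon> s = 0}" ereal]
      by (auto simp: bowen_pressure_at_def)
  qed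
  then show ?thesis unfolding bowen_pressure_eq_SUP by (intro SUP_least) auto
qed

section \<open>Lower bound for the Bowen pressure\<close>

lemma abs_birkhoff_sum_diff_le:
  assumes \<delta>: "\<And>k x' x''. x' \<in> mspace (X k) \<Longrightarrow> x'' \<in> mspace (X k) \<Longrightarrow> mdist (X k) x' x'' < \<delta> \<Longrightarrow>
      \<bar>f k x' - f k x''\<bar> < \<eta>"
    and x: "x \<in> mspace (X 0)" and y: "y \<in> bowen_ball X T n x \<delta>"
  shows "\<bar>birkhoff_sum T f n x - birkhoff_sum T f n y\<bar> \<le> real n * \<eta>"
proof -
  have "\<bar>f j (nds_iter T j x) - f j (nds_iter T j y)\<bar> \<le> \<eta>" if "j < n" for j
    using x y that by (intro less_imp_le \<delta> nds_iter_in_mspace[OF nds]) (auto simp: in_bowen_ball_iff)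
  then have "(\<Sum>j<n. \<bar>f j (nds_iter T j x) - f j (nds_iter T j y)\<bar>) \<le> (\<Sum>j<n. \<eta>)"
    by (intro sum_mono) auto
  moreover have "\<bar>birkhoff_sum T f n x - birkhoff_sum T f n y\<bar>
      \<le> (\<Sum>j<n. \<bar>f j (nds_iter T j x) - f j (nds_iter T j y)\<bar>)"
    unfolding birkhoff_sum_def sum_subtractf[symmetric] by (rule sum_abs)
  ultimately show ?thesis by simp
qed

text \<open>The margin 2\<eta> is spent in two halves: one is already in the exponent of the
  lightness bound, the other pays for moving the centre of the Birkhoff sum.\<close>

lemma light_points_subset_null:
  assumes equi: "equicontinuous_potential X f" and less: "bowen_pressure X T f E < ereal (s - 2 * \<eta>)"
    and "0 < \<eta>" "0 < r" and A: "A \<subseteq> E" "A \<subseteq> mspace (X 0)"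
    and light: "\<And>x n. x \<in> A \<Longrightarrow> k \<le> n \<Longrightarrow>
      prob (bowen_ball X T n x r) \<le> exp (- real n * (s - \<eta>) + birkhoff_sum T f n x)"
  shows "\<exists>U\<in>null_sets \<mu>. A \<subseteq> U"
proof (rule exists_null_superset)
  fix \<delta> :: real assume "\<delta> > 0"
  obtain d where d: "d > 0" "\<And>k x' x''. x' \<in> mspace (X k) \<Longrightarrow> x'' \<in> mspace (X k) \<Longrightarrow>
      mdist (X k) x' x'' < d \<Longrightarrow> \<bar>f k x' - f k x''\<bar> < \<eta>"
    using equi \<open>0 < \<eta>\<close> unfolding equicontinuous_potential_def by metis
  \<comment> \<open>The bound \<open>d\<close> controls the change of the Birkhoff sum under
    recentring; \<open>r / 2\<close> makes a recentred ball fit into radius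
    \<open>r\<close>.\<close>
  define \<epsilon> where "\<epsilon> = min d (r / 2)"
  have \<epsilon>: "0 < \<epsilon>" "\<epsilon> \<le> d" "2 * \<epsilon> \<le> r" using d(1) \<open>0 < r\<close> by (auto simp: \<epsilon>_def)
  have "bowen_pressure_at X T f E \<epsilon> < ereal (s - 2 * \<eta>)"
    by (rule le_less_trans[OF _ less]) (auto simp: bowen_pressure_eq_SUP \<epsilon>(1) intro: SUP_upper)
  then obtain t where t: "t < s - 2 * \<eta>" "bowen_R X T f E \<epsilon> t = 0"
    by (auto simp: bowen_pressure_at_def INF_less_iff)
  \<comment> \<open>A supremum equal to 0 vanishes at every stage. Stage \<open>k\<close> is chosen
    so that all orders of the cover lie in the range where lightness is assumed.\<close>
  have "bowen_R_N X T f E k \<epsilon> t \<le> 0"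
    using t(2) unfolding bowen_R_eq_SUP by (metis SUP_upper UNIV_I)
  also have "0 < ennreal \<delta>" using \<open>\<delta> > 0\<close> by simp
  finally obtain I n x where cov: "bowen_cover X T k \<epsilon> E I n x"
      and small: "(\<Sum>\<^sub>\<infinity>i\<in>I. ennreal (exp (- real (n i) * t + birkhoff_sum T f (n i) (x i)))) < ennreal \<delta>"
    unfolding bowen_R_N_def by (auto simp: INF_less_iff)
  define J where "J = {i\<in>I. bowen_ball X T (n i) (x i) \<epsilon> \<inter> A \<noteq> {}}"
  define U where "U = (\<Union>i\<in>J. bowen_ball X T (n i) (x i) \<epsilon>)"
  have xn: "x i \<in> mspace (X 0)" "k \<le> n i" if "i \<in> I" for i
    using cov that by (auto simp: bowen_cover_def)
  have meas: "bowen_ball X T (n i) (x i) \<epsilon> \<in> events" if "i \<in> J" for i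
    using that xn(1) bowen_ball_measurable by (simp add: J_def)
  have "emeasure \<mu> (bowen_ball X T (n i) (x i) \<epsilon>)
      \<le> ennreal (exp (- real (n i) * t + birkhoff_sum T f (n i) (x i)))" if iJ: "i \<in> J" for i
  proof -
    obtain y where y: "y \<in> bowen_ball X T (n i) (x i) \<epsilon>" "y \<in> A" and i: "i \<in> I"
      using iJ unfolding J_def by blast
    have yX: "y \<in> mspace (X 0)" using y A by blast
    have "bowen_ball X T (n i) (x i) \<epsilon> \<subseteq> bowen_ball X T (n i) y r"
    proof
      fix z assume "z \<in> bowen_ball X T (n i) (x i) \<epsilon>"
      then have "z \<in> bowen_ball X T (n i) y (\<epsilon> + \<epsilon>)"
        by (rule bowen_ball_triangle[OF nds yX bowen_ball_sym[OF nds xn(1)[OF i] y(1)]])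
      then show "z \<in> bowen_ball X T (n i) y r"
        using bowen_ball_mono[of "\<epsilon> + \<epsilon>" r X T "n i" y] \<epsilon>(3) by auto
    qed
    then have "prob (bowen_ball X T (n i) (x i) \<epsilon>) \<le> prob (bowen_ball X T (n i) y r)"
      by (intro finite_measure_mono bowen_ball_measurable yX)
    also have "\<dots> \<le> exp (- real (n i) * (s - \<eta>) + birkhoff_sum T f (n i) y)"
      by (rule light[OF y(2) xn(2)[OF i]])
    \<comment> \<open>Recentring costs at most n\<eta>, which turns the rate s-\<eta> into
      s-2\<eta>, and this still exceeds \<open>t\<close>.\<close>
    also have "\<dots> \<le> exp (- real (n i) * t + birkhoff_sum T f (n i) (x i))"
    proof -
      have "\<bar>birkhoff_sum T f (n i) (x i) - birkhoff_sum T f (n i) y\<bar> \<le> real (n i) * \<eta>"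
        by (rule abs_birkhoff_sum_diff_le[OF d(2) xn(1)[OF i] subsetD[OF bowen_ball_mono[OF \<epsilon>(2)] y(1)]])
      moreover have "real (n i) * t \<le> real (n i) * (s - 2 * \<eta>)"
        using t(1) by (intro mult_left_mono) auto
      ultimately show ?thesis by (simp add: algebra_simps)
    qed
    finally show ?thesis by (simp add: emeasure_eq_measure ennreal_leI)
  qed
  then have "emeasure \<mu> U \<le>
      (\<Sum>\<^sub>\<infinity>i\<in>I. ennreal (exp (- real (n i) * t + birkhoff_sum T f (n i) (x i))))"
    unfolding U_def using meas by (intro emeasure_UN_le_infsum) (auto simp: J_def)
  then have "emeasure \<mu> U \<le> ennreal \<delta>" using small by simp
  moreover have "U \<in> events" unfolding U_def using meas by (intro sets.countable_UN'') auto
  moreover have "A \<subseteq> U"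
    using cov A(1) unfolding U_def J_def bowen_cover_def by blast
  ultimately show "\<exists>U\<in>events. A \<subseteq> U \<and> emeasure \<mu> U \<le> ennreal \<delta>" by blast
qed

lemma bowen_pressure_ge:
  assumes equi: "equicontinuous_potential X f" and E: "E \<in> events" "0 < prob E"
    and ge: "\<And>x. x \<in> E \<Longrightarrow> ereal s \<le> lower_local_pressure X T \<mu> f x"
  shows "ereal s \<le> bowen_pressure X T f E"
proof (rule ccontr)
  assume "\<not> ?thesis"
  then obtain t where t: "bowen_pressure X T f E < ereal t" "t < s"
    using ereal_dense2 by (metis not_le less_ereal.simps(1))
  define \<eta> where "\<eta> = (s - t) / 2"
  have \<eta>: "0 < \<eta>" "t = s - 2 * \<eta>" using t(2) by (auto simp: \<eta>_def field_simps)
  have EX: "E \<subseteq> mspace (X 0)"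
    using E(1) by (rule events_subset_mspace)
  \<comment> \<open>One index serves both as inverse radius and as threshold for the orders, so
    countably many sets suffice; \<open>Suc\<close> keeps both positive.\<close>
  define A where "A k = {x\<in>E. \<forall>n\<ge>Suc k. prob (bowen_ball X T n x (1 / real (Suc k)))
      \<le> exp (- real n * (s - \<eta>) + birkhoff_sum T f n x)}" for k
  have "\<exists>U\<in>null_sets \<mu>. A k \<subseteq> U" for k
    by (rule light_points_subset_null[OF equi t(1)[unfolded \<eta>(2)] \<eta>(1), of "1 / real (Suc k)" _ "Suc k"])
       (use EX in \<open>auto simp: A_def\<close>)
  then obtain U where U: "\<And>k. U k \<in> null_sets \<mu>" "\<And>k. A k \<subseteq> U k" by metis
  have "E \<subseteq> (\<Union>k. A k)"
  proof
    fix x assume x: "x \<in> E"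
    then have xX: "x \<in> mspace (X 0)" using EX by blast
    have "ereal (s - \<eta>) < lower_local_pressure X T \<mu> f x"
      by (rule less_le_trans[OF _ ge[OF x]]) (use \<eta>(1) in simp)
    then obtain \<epsilon> where \<epsilon>: "0 < \<epsilon>" "ereal (s - \<eta>) < liminf (log_mass_rate X T \<mu> f x \<epsilon>)"
      unfolding lower_local_pressure_eq_SUP[OF xX] less_SUP_iff by auto
    then obtain N where N: "\<And>n. N \<le> n \<Longrightarrow> ereal (s - \<eta>) < log_mass_rate X T \<mu> f x \<epsilon> n"
      using less_LiminfD[OF \<epsilon>(2)] by (auto simp: eventually_sequentially)
    obtain M where M: "1 / real (Suc M) < \<epsilon>" using nat_approx_posE[OF \<epsilon>(1)] by blast
    \<comment> \<open>\<open>M\<close> makes the radius at most \<epsilon>, and \<open>N\<close>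
      puts all orders from \<open>Suc k\<close> on in the range where the rate exceeds
      s-\<eta>.\<close>
    define k where "k = max M N"
    have "1 / real (Suc k) \<le> 1 / real (Suc M)"
      by (intro divide_left_mono) (auto simp: k_def)
    then have k: "1 / real (Suc k) \<le> \<epsilon>" using M by simp
    have "prob (bowen_ball X T n x (1 / real (Suc k)))
        \<le> exp (- real n * (s - \<eta>) + birkhoff_sum T f n x)" if "Suc k \<le> n" for n
    proof -
      have "prob (bowen_ball X T n x (1 / real (Suc k))) \<le> prob (bowen_ball X T n x \<epsilon>)"
        by (intro finite_measure_mono bowen_ball_mono[OF k] bowen_ball_measurable xX)
      also have "\<dots> \<le> exp (- real n * (s - \<eta>) + birkhoff_sum T f n x)"
      proof -
        have "N \<le> n" "0 < n" using that by (auto simp: k_def)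
        from N[OF this(1)] log_rate_less_iff[OF this(2) measure_nonneg] show ?thesis
          by (metis less_asym linorder_not_less)
      qed
      finally show ?thesis .
    qed
    then show "x \<in> (\<Union>k. A k)" using x by (auto simp: A_def)
  qed
  then have "E \<subseteq> (\<Union>k. U k)" using U(2) by blast
  moreover have "(\<Union>k. U k) \<in> null_sets \<mu>" using U(1) by (intro null_sets_UN) auto
  ultimately have "E \<in> null_sets \<mu>" using E(1) by (metis null_sets_subset)
  then show False using E(2) by (simp add: null_sets_def measure_def)
qed

end

theorem theorem2p4:
  fixes X :: "nat \<Rightarrow> 'a metric"
    and T :: "nat \<Rightarrow> 'a \<Rightarrow> 'a"
    and f :: "nat \<Rightarrow> 'a \<Rightarrow> real"
    and \<mu> :: "'a measure"
    and E :: "'a set"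
    and s :: real
  assumes "nds X T"
    and "E \<in> sets (metric_borel (X 0))"
    and "prob_space \<mu>"
    and "sets \<mu> = sets (metric_borel (X 0))"
    and "continuous_potential X f"
  shows "((\<forall>x\<in>E. lower_local_pressure X T \<mu> f x \<le> ereal s)
            \<longrightarrow> bowen_pressure X T f E \<le> ereal s) \<and>
         (equicontinuous_potential X f \<and> (\<forall>x\<in>E. lower_local_pressure X T \<mu> f x \<ge> ereal s)
            \<and> measure \<mu> E > 0
            \<longrightarrow> bowen_pressure X T f E \<ge> ereal s)"
proof -
  interpret nds_prob_space \<mu> X T f
    using assms by (simp add: nds_prob_space_def nds_prob_space_axioms_def)
  have "E \<in> events" using assms(2,4) by simp
  moreover from this have "E \<subseteq> mspace (X 0)" by (rule events_subset_mspace)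
  ultimately show ?thesis
    using bowen_pressure_le[of E s] bowen_pressure_ge[of E s] by blast
qed

end
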